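(* Let $G$ be a connected graph and let $s,t\in V(G)$. Then $d_G(s,t)=1$ if and only if $\lambda_G(s,t)=1$.
   Context: Rendezvous game with adversaries. Let $G$ be a finite, simple, undirected, connected graph, let $s,t\in V(G)$ and let $k\ge 1$ be an integer. Two players play: Facilitator, who controls two agents $R$ and $J$ initially placed on $s$ and $t$ respectively, and Divider, who controls $k$ agents $D_1,\dots,D_k$ which Divider initially places on vertices of $V(G)\setminus\{s,t\}$ of his choice (several agents may share a vertex). After the initial placement the players alternate moves, Facilitator moving first. In a move, the player moves each of his agents to an adjacent vertex or leaves it where it is; no agent may be moved to a vertex currently occupied by an agent of the opponent. Both players have full information. Facilitator wins if at some moment $R$ and $J$ occupy the same vertex; Divider wins if this never happens. $d_G(s,t)$ (the $(s,t)$-dividing number) is the minimum $k$ such that Divider with $k$ agents has a winning strategy on $G$ against Facilitator starting from $s$ and $t$; $d_G(s,t)=+\infty$ if $s=t$ or $s,t$ are adjacent. $\lambda_G(s,t)$ is the minimum size of a set $S\subseteq V(G)\setminus\{s,t\}$ such that $s$ and $t$ lie in different connected components of $G-S$; $\lambda_G(s,t)=+\infty$ if $s=t$ or $s,t$ are adjacent. *)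

theory Defs
  imports Main "HOL-Library.Extended_Nat"
begin

definition simple_graph :: "'a set \<Rightarrow> ('a \<Rightarrow> 'a \<Rightarrow> bool) \<Rightarrow> bool" where
  "simple_graph V E \<longleftrightarrow> finite V \<and>
     (\<forall>x y. E x y \<longrightarrow> x \<in> V \<and> y \<in> V \<and> E y x \<and> x \<noteq> y)"

definition connected_graph :: "'a set \<Rightarrow> ('a \<Rightarrow> 'a \<Rightarrow> bool) \<Rightarrow> bool" where
  "connected_graph V E \<longleftrightarrow> (\<forall>x\<in>V. \<forall>y\<in>V. E\<^sup>*\<^sup>* x y)"

definition step :: "('a \<Rightarrow> 'a \<Rightarrow> bool) \<Rightarrow> 'a \<Rightarrow> 'a \<Rightarrow> bool" where
  "step E x y \<longleftrightarrow> x = y \<or> E x y"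

text \<open>Facilitator's move (r,j) to (r',j') while Divider's agents are at ds.\<close>
definition fac_legal :: "('a \<Rightarrow> 'a \<Rightarrow> bool) \<Rightarrow> 'a list \<Rightarrow> 'a \<Rightarrow> 'a \<Rightarrow> 'a \<Rightarrow> 'a \<Rightarrow> bool" where
  "fac_legal E ds r j r' j' \<longleftrightarrow> step E r r' \<and> step E j j' \<and> r' \<notin> set ds \<and> j' \<notin> set ds"

definition div_legal :: "('a \<Rightarrow> 'a \<Rightarrow> bool) \<Rightarrow> 'a \<Rightarrow> 'a \<Rightarrow> 'a list \<Rightarrow> 'a list \<Rightarrow> bool" where
  "div_legal E r j ds ds' \<longleftrightarrow> length ds' = length ds \<and>
     (\<forall>i<length ds. step E (ds ! i) (ds' ! i) \<and> ds' ! i \<noteq> r \<and> ds' ! i \<noteq> j)"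

text \<open>Divider's configurations along a play: D0 is the initial placement, and
after the Facilitator's (n+1)-st move Divider answers using the strategy sigma, which
sees the whole history of Facilitator positions after each of his moves
(Divider's own earlier positions are determined by D0 and sigma).\<close>
fun div_conf :: "'a list \<Rightarrow> (('a \<times> 'a) list \<Rightarrow> 'a list) \<Rightarrow> (nat \<Rightarrow> 'a) \<Rightarrow> (nat \<Rightarrow> 'a) \<Rightarrow> nat \<Rightarrow> 'a list" where
  "div_conf D0 \<sigma> r j 0 = D0"
| "div_conf D0 \<sigma> r j (Suc n) = \<sigma> (map (\<lambda>i. (r (Suc i), j (Suc i))) [0..<Suc n])"

definition divider_winning :: "('a \<Rightarrow> 'a \<Rightarrow> bool) \<Rightarrow> 'a \<Rightarrow> 'a \<Rightarrow> 'a list \<Rightarrow> (('a \<times> 'a) list \<Rightarrow> 'a list) \<Rightarrow> bool" where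
  "divider_winning E s t D0 \<sigma> \<longleftrightarrow> s \<noteq> t \<and>
     (\<forall>r j. r 0 = s \<longrightarrow> j 0 = t \<longrightarrow>
        (\<forall>n. (\<forall>m\<le>n. fac_legal E (div_conf D0 \<sigma> r j m) (r m) (j m) (r (Suc m)) (j (Suc m)))
              \<longrightarrow> r (Suc n) \<noteq> j (Suc n) \<and>
                  div_legal E (r (Suc n)) (j (Suc n)) (div_conf D0 \<sigma> r j n) (div_conf D0 \<sigma> r j (Suc n))))"

definition divider_wins :: "'a set \<Rightarrow> ('a \<Rightarrow> 'a \<Rightarrow> bool) \<Rightarrow> 'a \<Rightarrow> 'a \<Rightarrow> nat \<Rightarrow> bool" where
  "divider_wins V E s t k \<longleftrightarrow>
     (\<exists>D0 \<sigma>. length D0 = k \<and> set D0 \<subseteq> V - {s, t} \<and> divider_winning E s t D0 \<sigma>)"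

definition dividing_number :: "'a set \<Rightarrow> ('a \<Rightarrow> 'a \<Rightarrow> bool) \<Rightarrow> 'a \<Rightarrow> 'a \<Rightarrow> enat" where
  "dividing_number V E s t =
     (if s = t \<or> E s t then \<infinity>
      else Inf {enat k | k. k \<ge> 1 \<and> divider_wins V E s t k})"

definition separates :: "('a \<Rightarrow> 'a \<Rightarrow> bool) \<Rightarrow> 'a set \<Rightarrow> 'a \<Rightarrow> 'a \<Rightarrow> bool" where
  "separates E S s t \<longleftrightarrow> \<not> (\<lambda>x y. E x y \<and> x \<notin> S \<and> y \<notin> S)\<^sup>*\<^sup>* s t"

definition vertex_connectivity :: "'a set \<Rightarrow> ('a \<Rightarrow> 'a \<Rightarrow> bool) \<Rightarrow> 'a \<Rightarrow> 'a \<Rightarrow> enat" where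
  "vertex_connectivity V E s t =
     (if s = t \<or> E s t then \<infinity>
      else Inf {enat (card S) | S. S \<subseteq> V - {s, t} \<and> separates E S s t})"

end

theory Submission
  imports Defs
begin

text \<open>
  A single agent standing on a cut vertex wins for Divider. Conversely, if no vertex separates
  \<open>s\<close> from \<open>t\<close>, they lie on a common cycle, and we show that Divider has no safe position
  with \<open>R\<close> and \<open>J\<close> on a common cycle. Take such a position with a shortest cycle. Moving along an
  arc, Facilitator squeezes \<open>D\<close> until \<open>R\<close>, \<open>D\<close>, \<open>J\<close> occupy consecutive vertices \<open>a\<close>, \<open>x\<close>, \<open>b\<close>.
  By minimality the distances from \<open>x\<close> along the cycle are the distances in the graph: an ear
  shortcutting the cycle away from \<open>x\<close> gives a shorter cycle through \<open>a\<close> and \<open>b\<close>; and with an ear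
  starting at \<open>x\<close>, \<open>D\<close> must stay at \<open>x\<close> forever (otherwise \<open>R\<close> steps onto \<open>x\<close> and shares a shorter
  cycle with \<open>J\<close>), so \<open>J\<close> walks around to \<open>R\<close>. Hence \<open>R\<close> and \<open>J\<close>, running towards each other along
  the arc avoiding \<open>x\<close>, cannot be intercepted by \<open>D\<close>.
\<close>

section \<open>Cycles and ears\<close>

locale undirected =
  fixes E :: "'a \<Rightarrow> 'a \<Rightarrow> bool"
  assumes sym: "E x y \<Longrightarrow> E y x"
begin

definition cycle :: "'a list \<Rightarrow> bool" where
  "cycle c \<longleftrightarrow> c \<noteq> [] \<and> distinct c \<and> successively E c \<and> E (last c) (hd c)"

text \<open>The ear is not yet closed up: \<open>y\<close> is its last vertex so far, and \<open>y = u\<close> if \<open>w\<close> is empty.\<close>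

definition ear :: "'a set \<Rightarrow> 'a \<Rightarrow> 'a list \<Rightarrow> 'a \<Rightarrow> bool" where
  "ear C u w y \<longleftrightarrow> successively E (u # w) \<and> last (u # w) = y \<and> distinct w \<and> set w \<inter> C = {}"

lemma successively_rev_iff: "successively E (rev w) \<longleftrightarrow> successively E w"
proof -
  have "(\<lambda>x y. E y x) = E" using sym by blast
  then show ?thesis unfolding successively_rev by (rule arg_cong)
qed

lemma cycle_rotate:
  assumes "cycle (p @ q)"
  shows "cycle (q @ p)"
  using assms unfolding cycle_def
  by (cases "p = []"; cases "q = []") (auto simp: successively_append_iff)

lemma cycle_split:
  assumes "cycle c" "r \<in> set c" "j \<in> set c" "r \<noteq> j"
  obtains p q where "cycle (r # p @ j # q)" "length (r # p @ j # q) = length c"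
    "set (r # p @ j # q) = set c"
proof -
  obtain a b where c: "c = a @ r # b" using split_list assms(2) by metis
  then have "j \<in> set (b @ a)" using assms by auto
  then obtain p q where pq: "b @ a = p @ j # q" using split_list by metis
  have "cycle ((r # b) @ a)" using assms(1) c cycle_rotate by blast
  then have 1: "cycle (r # p @ j # q)" using pq by simp
  have "length (b @ a) = length (p @ j # q)" "set (b @ a) = set (p @ j # q)" by (simp_all only: pq)
  then have "length (r # p @ j # q) = length c" "set (r # p @ j # q) = set c" using c by auto
  with 1 that show thesis by blast
qed

text \<open>If the walk runs into its own ear, the ear is cut back to that vertex and stays
  distinct; so the length is only bounded.\<close>

lemma ear_extend:
  assumes "ear C u w y" "E y z" "z \<notin> C"
  obtains w' where "ear C u w' z" "length w' \<le> Suc (length w)"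
proof (cases "z \<in> set w")
  case True
  then obtain w1 w2 where w: "w = w1 @ z # w2" using split_list by metis
  then have "ear C u (w1 @ [z]) z"
    using assms(1) unfolding ear_def
    by (cases w1) (auto simp: successively_append_iff successively_Cons hd_append)
  then show thesis using that w by simp
next
  case False
  then have "ear C u (w @ [z]) z"
    using assms unfolding ear_def
    by (cases w) (auto simp: successively_append_iff successively_Cons hd_append)
  then show thesis using that by simp
qed

text \<open>The closed ear can replace either arc between \<open>u\<close> and \<open>v\<close>; in
  place of \<open>q\<close> it runs from \<open>v\<close> back to \<open>u\<close>, hence reversed.
  Together the two cycles cover the old one.\<close>

lemma ear_cycle:
  assumes c: "cycle (u # p @ v # q)" and w: "ear (set (u # p @ v # q)) u w y" and v: "E y v"
  shows "cycle (u # w @ v # q)" "cycle (u # p @ v # rev w)"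
proof -
  show "cycle (u # w @ v # q)"
    using c w v unfolding cycle_def ear_def
    by (cases w) (auto simp: successively_append_iff successively_Cons hd_append)
  show "cycle (u # p @ v # rev w)"
  proof (cases "w = []")
    case True
    then show ?thesis using c w sym[OF v] unfolding cycle_def ear_def
      by (auto simp: successively_append_iff successively_Cons hd_append)
  next
    case False
    then have "E u (hd w)" "last w = y" "successively E w"
      using w unfolding ear_def by (auto simp: successively_Cons)
    moreover from this have w': "successively E (rev w)"
      using successively_rev_iff by metis
    ultimately have "E (last (rev w)) u" "E v (hd (rev w))"
      using False sym v by (simp_all add: last_rev hd_rev)
    then show ?thesis
      using False c w w' unfolding cycle_def ear_def
      by (auto simp: successively_append_iff successively_Cons hd_append)
  qed
qed

section \<open>A common cycle of two vertices that no vertex separates\<close>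

lemma cycle_extend:
  assumes c: "cycle c" and s: "s \<in> set c" and w: "w \<in> set c" "w \<noteq> s" "E w t" "t \<noteq> w"
    and st: "(\<lambda>x y. E x y \<and> x \<noteq> w \<and> y \<noteq> w)\<^sup>*\<^sup>* s t"
  shows "\<exists>c'. cycle c' \<and> s \<in> set c' \<and> t \<in> set c'"
proof -
  \<comment> \<open>Follow the walk and restart the ear at each visit to \<open>c\<close>; the walk
    avoids \<open>w\<close>, so the root \<open>u\<close> does too.\<close>
  have "\<exists>u\<in>set c. \<exists>e. u \<noteq> w \<and> ear (set c) u e t"
    using st
  proof induction
    case base
    have "ear (set c) s [] s" by (simp add: ear_def)
    then show ?case using s w(2) by metis
  next
    case (step y z)
    show ?case
    proof (cases "z \<in> set c")
      case True
      have "ear (set c) z [] z" by (simp add: ear_def)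
      then show ?thesis using True step by blast
    next
      case False
      then show ?thesis using step ear_extend by metis
    qed
  qed
  then obtain u e where u: "u \<in> set c" "u \<noteq> w" and e: "ear (set c) u e t" by blast
  obtain p q where c': "cycle (u # p @ w # q)" and sc: "set (u # p @ w # q) = set c"
    using cycle_split[OF c u(1) w(1) u(2)] by metis
  \<comment> \<open>The edge between \<open>t\<close> and \<open>w\<close> closes the ear. Both
    cycles contain \<open>t\<close>, and one of them keeps \<open>s\<close>.\<close>
  note cyc = ear_cycle[OF c' e[folded sc] sym[OF w(3)]]
  have t: "t = u \<or> t \<in> set e" using e unfolding ear_def by (auto split: if_splits)
  have "s \<in> set (u # p @ w # q)" using s sc by simp
  then have "s \<in> set (u # p @ w # rev e) \<or> s \<in> set (u # e @ w # q)" by auto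
  moreover have "t \<in> set (u # e @ w # q)" "t \<in> set (u # p @ w # rev e)" using t by auto
  ultimately show ?thesis using cyc by blast
qed

lemma path_avoiding:
  assumes "(E ^^ m) s w" "\<And>k. k \<le> m \<Longrightarrow> \<not> (E ^^ k) s t"
  shows "(\<lambda>x y. E x y \<and> x \<noteq> t \<and> y \<noteq> t)\<^sup>*\<^sup>* s w"
  using assms
proof (induction m arbitrary: w)
  case 0
  then show ?case by simp
next
  case (Suc m)
  then obtain y where y: "(E ^^ m) s y" "E y w" by auto
  have "y \<noteq> t" "w \<noteq> t" using Suc.prems(1) Suc.prems(2)[of m] Suc.prems(2)[of "Suc m"] y(1)
    by (auto simp del: relpowp.simps)
  moreover have "(\<lambda>x y. E x y \<and> x \<noteq> t \<and> y \<noteq> t)\<^sup>*\<^sup>* s y"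
    using Suc.IH[OF y(1)] Suc.prems(2) le_SucI by blast
  ultimately show ?case using y(2) by (simp add: rtranclp.rtrancl_into_rtrancl)
qed

text \<open>The cycle \<^term>\<open>[s, t]\<close> is allowed here, so adjacent vertices need no exception.\<close>

lemma common_cycle:
  assumes "E\<^sup>*\<^sup>* s t" "s \<noteq> t"
    and "\<And>v. v \<noteq> s \<Longrightarrow> v \<noteq> t \<Longrightarrow> (\<lambda>x y. E x y \<and> x \<noteq> v \<and> y \<noteq> v)\<^sup>*\<^sup>* s t"
  shows "\<exists>c. cycle c \<and> s \<in> set c \<and> t \<in> set c"
proof -
  obtain k where "(E ^^ k) s t" using assms(1) rtranclp_power by metis
  then show ?thesis
    using assms(2,3)
  proof (induction k arbitrary: t rule: less_induct)
    case (less k)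
    show ?case
    proof (cases "\<exists>m<k. (E ^^ m) s t")
      case True
      then show ?thesis using less by blast
    next
      case False
      then have far: "\<And>m. m < k \<Longrightarrow> \<not> (E ^^ m) s t" by blast
      obtain m where k: "k = Suc m" using less.prems by (cases k) auto
      then obtain w where w: "(E ^^ m) s w" "E w t" using less.prems by auto
      have tw: "t \<noteq> w" using far[of m] w k by auto
      show ?thesis
      proof (cases "w = s")
        case True
        then have "cycle [s, t]" using w sym less.prems by (auto simp: cycle_def)
        then show ?thesis by (metis list.set_intros)
      next
        case ws: False
        \<comment> \<open>No vertex separates \<open>s\<close> from \<open>w\<close> either: the
          walk of length \<open>m\<close> misses \<open>t\<close>, as \<open>t\<close> is farther
          away; for other \<open>v\<close>, prolong a walk to \<open>t\<close> by the edge to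
          \<open>w\<close>.\<close>
        have "(\<lambda>x y. E x y \<and> x \<noteq> v \<and> y \<noteq> v)\<^sup>*\<^sup>* s w" if "v \<noteq> s" "v \<noteq> w" for v
        proof (cases "v = t")
          case True
          show ?thesis unfolding True by (rule path_avoiding[OF w(1)]) (use far k in auto)
        next
          case False
          then show ?thesis
            using less.prems(3)[of v] that sym[OF w(2)]
            by (simp add: rtranclp.rtrancl_into_rtrancl)
        qed
        then obtain c where "cycle c" "s \<in> set c" "w \<in> set c"
          using less.IH[of m w] k w ws by blast
        then show ?thesis
          using cycle_extend[of c s w t] ws tw w less.prems(3)[of w] by blast
      qed
    qed
  qed
qed

end

section \<open>Pursuit against a single agent of Divider\<close>

text \<open>\<open>W r j d\<close>: an invariant of positions with Facilitator to move that
  Divider, with one agent at \<open>d\<close>, can maintain forever.\<close>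

locale guarded = undirected E for E :: "'a \<Rightarrow> 'a \<Rightarrow> bool" +
  fixes W :: "'a \<Rightarrow> 'a \<Rightarrow> 'a \<Rightarrow> bool"
  assumes free: "W r j d \<Longrightarrow> d \<noteq> r \<and> d \<noteq> j \<and> r \<noteq> j"
    and respond: "W r j d \<Longrightarrow> step E r r' \<Longrightarrow> step E j j' \<Longrightarrow> r' \<noteq> d \<Longrightarrow> j' \<noteq> d
      \<Longrightarrow> \<exists>d'. step E d d' \<and> W r' j' d'"
begin

lemma not_meet:
  assumes "W r j d" "step E r z" "step E j z" "z \<noteq> d"
  shows False
  using respond[OF assms(1-3)] assms(4) free by blast

lemma not_adjacent: "W r j d \<Longrightarrow> \<not> E r j"
  using not_meet[of r j d j] free[of r j d] by (auto simp: step_def)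

text \<open>\<open>R\<close> advances along the arc \<open>p\<close> unless \<open>D\<close> is
  right in front of it; then \<open>J\<close> advances from the other end. The arc shrinks to
  \<open>[d]\<close>, never to \<open>[]\<close>, as \<open>R\<close> and \<open>J\<close> cannot be
  adjacent.\<close>

lemma squeeze:
  assumes "W r j d" "cycle (r # p @ j # q)"
  shows "\<exists>a b x q'. W a b x \<and> cycle (a # x # b # q') \<and>
    length (a # x # b # q') = length (r # p @ j # q)"
  using assms
proof (induction p arbitrary: r j d q rule: length_induct)
  case (1 p)
  show ?case
  proof (cases p)
    case Nil
    then have "E r j" using 1 by (auto simp: cycle_def)
    then show ?thesis using 1 not_adjacent by blast
  next
    case (Cons z p')
    show ?thesis
    proof (cases "z = d")
      case False
      have "E r z" using 1(3) Cons by (auto simp: cycle_def)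
      then obtain d' where d': "W z j d'"
        using respond[OF 1(2), of z j] free[OF 1(2)] False by (auto simp: step_def)
      have c: "cycle (z # p' @ j # (q @ [r]))"
        using cycle_rotate[of "[r]" "z # p' @ j # q"] 1(3) Cons by simp
      have "length p' < length p" using Cons by simp
      from 1(1)[rule_format, OF this d' c]
      show ?thesis using Cons by simp
    next
      case z: True
      show ?thesis
      proof (cases p' rule: rev_cases)
        case Nil
        then show ?thesis using z Cons 1(2,3) by auto
      next
        case (snoc p'' y)
        have "y \<noteq> d" using z 1(3) Cons snoc by (auto simp: cycle_def)
        have "E y j" using 1(3) Cons snoc
          by (auto simp: cycle_def successively_append_iff successively_Cons)
        then have "E j y" by (rule sym)
        then obtain d' where d': "W r y d'"
          using respond[OF 1(2), of r y] free[OF 1(2)] \<open>y \<noteq> d\<close> by (auto simp: step_def)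
        have c: "cycle (r # (z # p'') @ y # (j # q))"
          using 1(3) Cons snoc by simp
        have "length (z # p'') < length p" using Cons snoc by simp
        from 1(1)[rule_format, OF this d' c]
        show ?thesis using Cons snoc by simp
      qed
    qed
  qed
qed

text \<open>Running towards each other along \<open>q\<close>, \<open>J\<close> needs
  \<open>Suc i\<close> moves to \<open>q ! i\<close> and \<open>R\<close> needs
  \<open>length q - i\<close>; \<open>D\<close> is assumed slower than the faster of them. Since
  \<open>step\<close> allows waiting, \<open>step E ^^ k\<close> means within \<open>k\<close>
  moves.\<close>

lemma race:
  assumes "W r j d" "successively E (j # q @ [r])"
    and "\<And>i k. i < length q \<Longrightarrow> (step E ^^ k) d (q ! i) \<Longrightarrow> min (Suc i) (length q - i) < k"
  shows False
  using assms
proof (induction q arbitrary: r j d rule: length_induct)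
  case (1 q)
  show ?case
  proof (cases q)
    case Nil
    then have "E j r" using 1(3) by simp
    then show ?thesis using sym[of j r] not_adjacent[OF 1(2)] by simp
  next
    case (Cons y q')
    have ends: "z \<noteq> d" if z: "z \<in> set q" for z
    proof -
      obtain i where "i < length q" "q ! i = z" using z by (metis in_set_conv_nth)
      then show ?thesis using 1(4)[of i 0] by auto
    qed
    show ?thesis
    proof (cases q' rule: rev_cases)
      case Nil
      then have "E j y" "E y r" using 1(3) Cons by auto
      then have "E j y" "E r y" by (simp_all add: sym[of y r])
      then show ?thesis using not_meet[OF 1(2), of y] ends Cons by (auto simp: step_def)
    next
      case (snoc q'' z)
      have q: "q = y # q'' @ [z]" using Cons snoc by simp
      have "successively E ([j] @ (y # q'' @ [z]) @ [r])" using 1(3) q by simp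
      then have "E j y" "E z r" and c: "successively E (y # q'' @ [z])"
        unfolding successively_append_iff[of E "[j]"] successively_append_iff[of E _ "[r]"]
        by simp_all
      then have "E j y" "E r z" by (simp_all add: sym[of z r])
      then obtain d' where d': "step E d d'" "W z y d'"
        using respond[OF 1(2), of z y] ends q by (auto simp: step_def)
      \<comment> \<open>A round removes both ends of \<open>q\<close>; with the index shifted by
        one, all three move counts drop by one.\<close>
      have "min (Suc i) (length q'' - i) < k"
        if "i < length q''" "(step E ^^ k) d' (q'' ! i)" for i k
      proof -
        have "(step E ^^ Suc k) d (q ! Suc i)"
          using relpowp_Suc_I2[OF d'(1) that(2)] that(1) q by (simp add: nth_append)
        from 1(4)[OF _ this] that q show ?thesis by simp
      qed
      moreover have "length q'' < length q" using q by simp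
      ultimately show False using 1(1)[rule_format, OF _ d'(2) c] by blast
    qed
  qed
qed

end

section \<open>Distances along a shortest cycle\<close>

text \<open>\<open>D\<close> stands at index 0 of \<open>c\<close>, \<open>J\<close> at index 1,
  \<open>R\<close> at the last index. So \<open>min i (length c - i)\<close> is the distance of
  \<open>c ! i\<close> from \<open>D\<close> along \<open>c\<close>.\<close>

locale tight = guarded +
  fixes a b x q c
  assumes W: "W a b x"
    and c_def: "c = x # b # q @ [a]"
    and cyc: "cycle c"
    and minimal: "\<And>c' r j d. cycle c' \<Longrightarrow> length c' < length c
      \<Longrightarrow> r \<in> set c' \<Longrightarrow> j \<in> set c' \<Longrightarrow> \<not> W r j d"
begin

lemma split_pair:
  assumes "i < k" "k < length c"
  shows "c = take i c @ c ! i # take (k - Suc i) (drop (Suc i) c) @ c ! k # drop (Suc k) c"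
proof -
  have "drop (Suc i) c = take (k - Suc i) (drop (Suc i) c) @ drop k c"
    using assms by (metis Suc_leI append_take_drop_id drop_drop le_add_diff_inverse2)
  then show ?thesis using assms by (metis Cons_nth_drop_Suc id_take_nth_drop less_trans)
qed

lemma pinned_shortcut:
  assumes "0 < k" "k < length c" "ear (set c) x w y" "E y (c ! k)"
  shows "k \<le> Suc (length w) \<or> length c - k \<le> Suc (length w)"
proof (rule ccontr)
  assume short: "\<not> ?thesis"
  define p where "p = take (k - 1) (drop 1 c)"
  define z where "z = drop (Suc k) c"
  have c0: "c ! 0 = x" by (simp add: c_def)
  have c: "c = x # p @ c ! k # z"
    using split_pair[of 0 k] assms c0 by (simp add: p_def z_def)
  have len: "length p = k - 1" "length z = length c - Suc k"
    using assms by (auto simp: p_def z_def)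
  have c1: "cycle (x # p @ c ! k # z)" and e: "ear (set (x # p @ c ! k # z)) x w y"
    using cyc assms(3) c by simp_all
  note cycs = ear_cycle[OF c1 e assms(4)]
  have lens: "length (x # w @ c ! k # z) < length c" "length (x # p @ c ! k # rev w) < length c"
    using short len assms by auto
  \<comment> \<open>Each vertex of \<open>c\<close> lies on one of two shorter cycles through
    \<open>x\<close>.\<close>
  have off: "\<not> W x v d" if "v \<in> set c" for v d
  proof -
    have "v \<in> set (x # p @ c ! k # z)" using that c by simp
    then have "v \<in> set (x # w @ c ! k # z) \<or> v \<in> set (x # p @ c ! k # rev w)" by auto
    then show ?thesis using minimal[OF cycs(1) lens(1)] minimal[OF cycs(2) lens(2)] by auto
  qed
  have ax: "E a x" using cyc by (simp add: c_def cycle_def)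
  \<comment> \<open>\<open>R\<close> waits at \<open>a\<close> while \<open>J\<close> walks around
    \<open>c\<close> from \<open>b\<close>. If \<open>D\<close> leaves \<open>x\<close>, then
    \<open>R\<close> steps there, against \<open>off\<close>.\<close>
  have "W a (c ! Suc i) x" if "Suc i < length c" for i
    using that
  proof (induction i)
    case 0
    then show ?case using W by (simp add: c_def)
  next
    case (Suc i)
    have m: "W a (c ! Suc i) x" using Suc by simp
    have "E (c ! Suc i) (c ! Suc (Suc i))"
      using cyc Suc.prems by (auto simp: cycle_def successively_conv_nth)
    moreover have "c ! Suc (Suc i) \<noteq> x"
      using cyc Suc.prems c0 unfolding cycle_def
      by (metis Suc_lessD nat.distinct(1) nth_eq_iff_index_eq zero_less_Suc less_trans)
    ultimately obtain d where d: "step E x d" "W a (c ! Suc (Suc i)) d"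
      using respond[OF m, of a "c ! Suc (Suc i)"] free[OF m] by (auto simp: step_def)
    show ?case
    proof (cases "d = x")
      case True
      then show ?thesis using d by simp
    next
      case False
      then obtain d' where "W x (c ! Suc (Suc i)) d'"
        using respond[OF d(2), of x "c ! Suc (Suc i)"] free[OF d(2)] ax by (auto simp: step_def)
      then show ?thesis using off nth_mem[OF Suc.prems] by blast
    qed
  qed
  \<comment> \<open>Index \<open>Suc (Suc (length q))\<close> is the last of \<open>c\<close>:
    \<open>J\<close> has reached \<open>R\<close>.\<close>
  from this[of "Suc (length q)"] have "W a a x" by (simp add: c_def nth_append)
  then show False using free by blast
qed

text \<open>The interior of the arc from index \<open>i\<close> to \<open>k\<close> contains neither
  \<open>a\<close> nor \<open>b\<close>. A shorter ear in its place would give a shorter cycle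
  through both, against \<open>minimal\<close>.\<close>

lemma free_shortcut:
  assumes "0 < i" "i < k" "k < length c" "ear (set c) (c ! i) w y" "E y (c ! k)"
  shows "k - i \<le> Suc (length w)"
proof (rule ccontr)
  assume short: "\<not> ?thesis"
  define p where "p = take (k - Suc i) (drop (Suc i) c)"
  define z where "z = drop (Suc k) c"
  define h where "h = take i c"
  have c: "c = h @ c ! i # p @ c ! k # z"
    using split_pair[of i k] assms by (simp add: p_def z_def h_def)
  have set_c: "set c = set (c ! i # p @ c ! k # z @ h)" by (subst c) auto
  have c1: "cycle (c ! i # p @ c ! k # z @ h)"
    using cycle_rotate[of h "c ! i # p @ c ! k # z"] cyc c by simp
  let ?c = "c ! i # w @ c ! k # z @ h"
  have cy: "cycle ?c"
    using ear_cycle(1)[OF c1] assms(4,5) set_c by metis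
  have len: "length h = i" "length z = length c - Suc k" using assms by (auto simp: h_def z_def)
  then have l: "length ?c < length c" using short assms by auto
  have "a \<in> set (c ! k # z)"
  proof -
    have "a = last c" by (simp add: c_def)
    also have "\<dots> = last (c ! k # z)" by (subst c) simp
    finally show ?thesis by (metis last_in_set list.distinct(1))
  qed
  moreover have "b \<in> set (h @ [c ! i])"
  proof -
    have "h @ [c ! i] = take (Suc i) c" using assms by (simp add: h_def take_Suc_conv_app_nth)
    then show ?thesis using assms(1) by (cases i) (auto simp: c_def)
  qed
  ultimately have "a \<in> set ?c" "b \<in> set ?c" by auto
  then show False using minimal[OF cy l] W by blast
qed

lemma ear_reverse:
  assumes "ear C u w y" "E y v" "v \<notin> set w"
  obtains y' where "ear C v (rev w) y'" "E y' u"
proof (cases "w = []")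
  case True
  then show thesis using assms that[of v] sym by (auto simp: ear_def)
next
  case False
  then have w: "E u (hd w)" "successively E (rev w)" "last w = y" "distinct w" "set w \<inter> C = {}"
    using assms(1) successively_rev_iff[of w] by (simp_all add: ear_def successively_Cons)
  then have "ear C v (rev w) (hd w)"
    using False sym[OF assms(2)] by (simp add: ear_def successively_Cons hd_rev last_rev)
  moreover have "E (hd w) u" using w(1) by (rule sym)
  ultimately show thesis by (rule that)
qed

text \<open>Ears at \<open>x\<close> fall under \<open>pinned_shortcut\<close>, ears between two
  other vertices under \<open>free_shortcut\<close>, after reversal if they run to a smaller
  index.\<close>

lemma ear_bound:
  assumes "i < length c" "k < length c" "ear (set c) (c ! i) w y" "E y (c ! k)"
  shows "min k (length c - k) \<le> min i (length c - i) + Suc (length w)"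
proof -
  have c0: "c ! 0 = x" by (simp add: c_def)
  have "c ! k \<notin> set w" using assms(2,3) nth_mem unfolding ear_def by blast
  then obtain y' where y': "ear (set c) (c ! k) (rev w) y'" "E y' (c ! i)"
    using ear_reverse assms by metis
  consider "i = k" | "i = 0" "k > 0" | "k = 0" | "0 < i" "i < k" | "0 < k" "k < i" by linarith
  then show ?thesis
  proof cases
    case 2
    then show ?thesis using pinned_shortcut[of k w y] assms c0 by auto
  next
    case 4
    then show ?thesis using free_shortcut[of i k w y] assms by auto
  next
    case 5
    then show ?thesis using free_shortcut[of k i "rev w" y'] assms y' by auto
  qed auto
qed

text \<open>Track a cycle vertex visited by \<open>D\<close> and the ear grown from it; on a return
  to \<open>c\<close> the ear is emptied and \<open>ear_bound\<close> pays for it. So no walk beats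
  the way along \<open>c\<close>.\<close>

lemma walk_bound:
  assumes "(step E ^^ m) x y"
  shows "\<exists>i<length c. \<exists>w. ear (set c) (c ! i) w y \<and> min i (length c - i) + length w \<le> m"
  using assms
proof (induction m arbitrary: y)
  case 0
  then show ?case by (intro exI[of _ 0] exI[of _ "[]"] conjI) (simp_all add: c_def ear_def)
next
  case (Suc m)
  then obtain v where v: "(step E ^^ m) x v" "step E v y" by auto
  obtain i w where i: "i < length c" "ear (set c) (c ! i) w v" "min i (length c - i) + length w \<le> m"
    using Suc.IH[OF v(1)] by blast
  show ?case
  proof (cases "v = y")
    case True
    then show ?thesis using i by (metis le_SucI)
  next
    case False
    then have vy: "E v y" using v(2) by (simp add: step_def)
    show ?thesis
    proof (cases "y \<in> set c")
      case True
      then obtain k where k: "k < length c" "c ! k = y" by (metis in_set_conv_nth)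
      then have "min k (length c - k) \<le> Suc m"
        using ear_bound[OF i(1) k(1) i(2)] vy i(3) by simp
      moreover have "ear (set c) (c ! k) [] y" using k by (simp add: ear_def)
      ultimately show ?thesis using k(1) by (metis add.right_neutral list.size(3))
    next
      case False
      then obtain w' where "ear (set c) (c ! i) w' y" "length w' \<le> Suc (length w)"
        using ear_extend i(2) vy by metis
      moreover then have "min i (length c - i) + length w' \<le> Suc m" using i(3) by simp
      ultimately show ?thesis using i(1) by blast
    qed
  qed
qed

lemma contradiction: False
proof (rule race[OF W])
  show "successively E (b # q @ [a])"
    using cyc by (simp add: cycle_def c_def)
next
  fix i k
  assume i: "i < length q" and k: "(step E ^^ k) x (q ! i)"
  obtain l w where l: "l < length c" "ear (set c) (c ! l) w (q ! i)"
      "min l (length c - l) + length w \<le> k"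
    using walk_bound[OF k] by blast
  \<comment> \<open>The distance of this vertex from \<open>x\<close> along \<open>c\<close> is one
    more than \<open>min (Suc i) (length q - i)\<close>, whence the strict inequality.\<close>
  have qi: "q ! i = c ! Suc (Suc i)" using i by (simp add: c_def nth_append)
  have i': "Suc (Suc i) < length c" using i by (simp add: c_def)
  have "w = []"
    using l(2) nth_mem[OF i'] qi unfolding ear_def
    by (metis disjoint_iff last_ConsR last_in_set)
  then have "c ! l = c ! Suc (Suc i)" using l(2) qi by (simp add: ear_def)
  then have "l = Suc (Suc i)"
    using cyc l(1) i' nth_eq_iff_index_eq unfolding cycle_def by blast
  then show "min (Suc i) (length q - i) < k" using l(3) i by (simp add: c_def)
qed

end

context guarded
begin

lemma no_common_cycle:
  assumes "cycle c" "r \<in> set c" "j \<in> set c"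
  shows "\<not> W r j d"
  using assms
proof (induction c arbitrary: r j d rule: length_induct)
  case (1 c)
  show ?case
  proof
    assume w: "W r j d"
    obtain p q where "cycle (r # p @ j # q)" "length (r # p @ j # q) = length c"
      using cycle_split[OF 1(2-4)] free[OF w] by metis
    then obtain a b x q' where t: "W a b x" "cycle (a # x # b # q')"
        "length (a # x # b # q') = length c"
      using squeeze[OF w] by metis
    \<comment> \<open>\<open>squeeze\<close> keeps the length, so the induction hypothesis yields
      \<open>minimal\<close>.\<close>
    interpret tight E W a b x q' "x # b # q' @ [a]"
    proof
      show "cycle (x # b # q' @ [a])" using cycle_rotate[of "[a]" "x # b # q'"] t(2) by simp
    qed (use t 1(1) in auto)
    show False by (rule contradiction)
  qed
qed

end

section \<open>From a winning strategy to an invariant of positions\<close>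

lemma div_conf_cong:
  assumes "\<And>i. i \<le> n \<Longrightarrow> r i = r' i" "\<And>i. i \<le> n \<Longrightarrow> j i = j' i"
  shows "div_conf D0 \<sigma> r j n = div_conf D0 \<sigma> r' j' n"
proof (cases n)
  case (Suc m)
  have "map (\<lambda>i. (r (Suc i), j (Suc i))) [0..<Suc m] = map (\<lambda>i. (r' (Suc i), j' (Suc i))) [0..<Suc m]"
    by (rule map_cong) (use assms Suc in auto)
  then show ?thesis unfolding Suc div_conf.simps by (rule arg_cong)
qed simp

text \<open>Quantifying over the play turns a history-dependent strategy into a relation on
  positions: whichever history led here, \<open>\<sigma>\<close> can continue it.\<close>

definition reached ::
  "('a \<Rightarrow> 'a \<Rightarrow> bool) \<Rightarrow> 'a \<Rightarrow> 'a \<Rightarrow> 'a list \<Rightarrow> (('a \<times> 'a) list \<Rightarrow> 'a list) \<Rightarrow> 'a \<Rightarrow> 'a \<Rightarrow> 'a \<Rightarrow> bool" where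
  "reached E s t D0 \<sigma> r' j' d \<longleftrightarrow> (\<exists>r j n. r 0 = s \<and> j 0 = t \<and> r n = r' \<and> j n = j' \<and>
     div_conf D0 \<sigma> r j n = [d] \<and>
     (\<forall>m<n. fac_legal E (div_conf D0 \<sigma> r j m) (r m) (j m) (r (Suc m)) (j (Suc m))))"

lemma reached_guarded:
  assumes sym: "\<And>x y. E x y \<Longrightarrow> E y x"
    and win: "divider_winning E s t [d0] \<sigma>" and d0: "d0 \<noteq> s" "d0 \<noteq> t"
  shows "guarded E (reached E s t [d0] \<sigma>)"
proof -
  have answer: "r (Suc n) \<noteq> j (Suc n) \<and>
      div_legal E (r (Suc n)) (j (Suc n)) (div_conf [d0] \<sigma> r j n) (div_conf [d0] \<sigma> r j (Suc n))"
    if "r 0 = s" "j 0 = t"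
      "\<And>m. m \<le> n \<Longrightarrow> fac_legal E (div_conf [d0] \<sigma> r j m) (r m) (j m) (r (Suc m)) (j (Suc m))"
    for r j n
    using win that unfolding divider_winning_def by blast
  show ?thesis
  proof
    fix x y
    show "E x y \<Longrightarrow> E y x" by (rule sym)
  next
    fix r' j' d
    assume "reached E s t [d0] \<sigma> r' j' d"
    then obtain r j n where p: "r 0 = s" "j 0 = t" "r n = r'" "j n = j'" "div_conf [d0] \<sigma> r j n = [d]"
        "\<And>m. m < n \<Longrightarrow> fac_legal E (div_conf [d0] \<sigma> r j m) (r m) (j m) (r (Suc m)) (j (Suc m))"
      unfolding reached_def by blast
    show "d \<noteq> r' \<and> d \<noteq> j' \<and> r' \<noteq> j'"
    proof (cases n)
      case 0
      then show ?thesis using p d0 win by (auto simp: divider_winning_def)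
    next
      case (Suc k)
      have "r n \<noteq> j n \<and> div_legal E (r n) (j n) (div_conf [d0] \<sigma> r j k) (div_conf [d0] \<sigma> r j n)"
        using answer[of r j k] p(1,2,6) Suc by auto
      then have "r' \<noteq> j' \<and> div_legal E r' j' (div_conf [d0] \<sigma> r j k) [d]"
        using p(3-5) by simp
      then show ?thesis unfolding div_legal_def by (metis length_Cons nth_Cons_0 zero_less_Suc)
    qed
  next
    fix r1 j1 d r2 j2
    assume mv: "step E r1 r2" "step E j1 j2" "r2 \<noteq> d" "j2 \<noteq> d"
    assume "reached E s t [d0] \<sigma> r1 j1 d"
    then obtain r j n where p: "r 0 = s" "j 0 = t" "r n = r1" "j n = j1" "div_conf [d0] \<sigma> r j n = [d]"
        "\<And>m. m < n \<Longrightarrow> fac_legal E (div_conf [d0] \<sigma> r j m) (r m) (j m) (r (Suc m)) (j (Suc m))"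
      unfolding reached_def by blast
    \<comment> \<open>Only time \<open>Suc n\<close> is changed, so Divider's configurations up to
      time \<open>n\<close> remain.\<close>
    define r' where "r' = r(Suc n := r2)"
    define j' where "j' = j(Suc n := j2)"
    have conf: "div_conf [d0] \<sigma> r' j' m = div_conf [d0] \<sigma> r j m" if "m \<le> n" for m
      by (rule div_conf_cong) (use that in \<open>auto simp: r'_def j'_def\<close>)
    have ends: "r' 0 = s" "j' 0 = t" "r' (Suc n) = r2" "j' (Suc n) = j2"
      using p by (auto simp: r'_def j'_def)
    have legal: "fac_legal E (div_conf [d0] \<sigma> r' j' m) (r' m) (j' m) (r' (Suc m)) (j' (Suc m))"
      if "m \<le> n" for m
    proof (cases "m = n")
      case True
      then show ?thesis using conf[of n] p(3-5) mv by (simp add: fac_legal_def r'_def j'_def)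
    next
      case False
      then show ?thesis using conf[of m] p(6)[of m] that by (simp add: r'_def j'_def)
    qed
    have "div_legal E r2 j2 (div_conf [d0] \<sigma> r' j' n) (div_conf [d0] \<sigma> r' j' (Suc n))"
      using answer[of r' j' n, OF ends(1,2) legal] ends(3,4) by simp
    then have dl: "div_legal E r2 j2 [d] (div_conf [d0] \<sigma> r' j' (Suc n))"
      using conf[of n] p(5) by simp
    then obtain d' where d': "div_conf [d0] \<sigma> r' j' (Suc n) = [d']"
      unfolding div_legal_def by (metis length_0_conv length_Suc_conv)
    then have "step E d d'" using dl by (simp add: div_legal_def)
    moreover have "reached E s t [d0] \<sigma> r2 j2 d'"
      unfolding reached_def using ends d' legal less_Suc_eq_le by blast
    ultimately show "\<exists>d'. step E d d' \<and> reached E s t [d0] \<sigma> r2 j2 d'" by blast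
  qed
qed

section \<open>Cut vertices and one agent\<close>

lemma cut_vertex_if_divider_wins:
  assumes G: "simple_graph V E" "connected_graph V E" "s \<in> V" "t \<in> V"
    and win: "divider_wins V E s t 1"
  shows "\<exists>v\<in>V - {s, t}. separates E {v} s t"
proof (rule ccontr)
  assume nocut: "\<not> ?thesis"
  obtain d0 \<sigma> where d0: "d0 \<noteq> s" "d0 \<noteq> t" and w: "divider_winning E s t [d0] \<sigma>"
  proof -
    obtain D0 \<sigma> where "length D0 = 1" "set D0 \<subseteq> V - {s, t}" "divider_winning E s t D0 \<sigma>"
      using win unfolding divider_wins_def by blast
    then show thesis using that by (cases D0) auto
  qed
  interpret guarded E "reached E s t [d0] \<sigma>"
    by (rule reached_guarded[OF _ w d0]) (use G(1) in \<open>simp add: simple_graph_def\<close>)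
  have conn: "E\<^sup>*\<^sup>* s t" using G by (simp add: connected_graph_def)
  have "(\<lambda>x y. E x y \<and> x \<noteq> v \<and> y \<noteq> v)\<^sup>*\<^sup>* s t" if "v \<noteq> s" "v \<noteq> t" for v
  proof (cases "v \<in> V")
    case True
    then show ?thesis using nocut that by (auto simp: separates_def)
  next
    \<comment> \<open>\<open>common_cycle\<close> asks about every \<open>v\<close> of the type; no
      edge touches a \<open>v\<close> outside \<open>V\<close>.\<close>
    case False
    then have "(\<lambda>x y. E x y \<and> x \<noteq> v \<and> y \<noteq> v) = E"
      using G(1) unfolding simple_graph_def by blast
    then show ?thesis using conn by simp
  qed
  moreover have "s \<noteq> t" using w by (simp add: divider_winning_def)
  ultimately obtain c where "cycle c" "s \<in> set c" "t \<in> set c"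
    using common_cycle conn by blast
  moreover have "reached E s t [d0] \<sigma> s t d0"
    unfolding reached_def by (rule exI[of _ "\<lambda>_. s"], rule exI[of _ "\<lambda>_. t"], rule exI[of _ 0]) simp
  ultimately show False using no_common_cycle by blast
qed

text \<open>\<open>D\<close> waits on \<open>v\<close>, so \<open>R\<close> and \<open>J\<close>
  stay in different components of the graph without \<open>v\<close>.\<close>

lemma divider_wins_if_cut_vertex:
  assumes G: "simple_graph V E" and v: "v \<in> V - {s, t}" and sep: "separates E {v} s t"
  shows "divider_wins V E s t 1"
proof -
  let ?E = "\<lambda>x y. E x y \<and> x \<notin> {v} \<and> y \<notin> {v}"
  let ?\<sigma> = "\<lambda>_ :: ('a \<times> 'a) list. [v]"
  have conf: "div_conf [v] ?\<sigma> r j n = [v]" for r j n by (cases n) auto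
  have rev: "?E\<^sup>*\<^sup>* y x" if "?E\<^sup>*\<^sup>* x y" for x y
  proof -
    have "symp ?E" using G by (auto simp: symp_def simple_graph_def)
    then show ?thesis by (rule sympD[OF symp_rtranclp that])
  qed
  have stays: "p n \<noteq> v \<and> ?E\<^sup>*\<^sup>* (p 0) (p n)"
    if "p 0 \<noteq> v" "\<And>m. m < n \<Longrightarrow> step E (p m) (p (Suc m)) \<and> p (Suc m) \<noteq> v" for p :: "nat \<Rightarrow> 'a" and n
    using that
  proof (induction n)
    case (Suc n)
    then have "p n \<noteq> v" "?E\<^sup>*\<^sup>* (p 0) (p n)" "step E (p n) (p (Suc n))" "p (Suc n) \<noteq> v" by simp_all
    then show ?case unfolding step_def by (auto intro: rtranclp.rtrancl_into_rtrancl)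
  qed simp
  have "divider_winning E s t [v] ?\<sigma>"
    unfolding divider_winning_def conf
  proof (intro conjI allI impI)
    show "s \<noteq> t" using sep by (auto simp: separates_def)
  next
    fix r j :: "nat \<Rightarrow> 'a" and n
    assume p: "r 0 = s" "j 0 = t" "\<forall>m\<le>n. fac_legal E [v] (r m) (j m) (r (Suc m)) (j (Suc m))"
    have r: "r (Suc n) \<noteq> v \<and> ?E\<^sup>*\<^sup>* s (r (Suc n))"
      using stays[of r "Suc n"] p v by (auto simp: fac_legal_def less_Suc_eq_le)
    have j: "j (Suc n) \<noteq> v \<and> ?E\<^sup>*\<^sup>* t (j (Suc n))"
      using stays[of j "Suc n"] p v by (auto simp: fac_legal_def less_Suc_eq_le)
    show "r (Suc n) \<noteq> j (Suc n)"
    proof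
      assume "r (Suc n) = j (Suc n)"
      then have "?E\<^sup>*\<^sup>* (r (Suc n)) t" using rev[OF j[THEN conjunct2]] by simp
      then have "?E\<^sup>*\<^sup>* s t" using r by (metis (no_types, lifting) rtranclp_trans)
      then show False using sep by (simp add: separates_def)
    qed
    show "div_legal E (r (Suc n)) (j (Suc n)) [v] [v]"
      using r j by (auto simp: div_legal_def step_def)
  qed
  then show ?thesis using v unfolding divider_wins_def
    by (intro exI[of _ "[v]"] exI[of _ ?\<sigma>]) auto
qed

text \<open>An infimum in \<open>enat\<close> is attained, except that the empty set has infimum
  infinity.\<close>

lemma Inf_enat_eq_1_iff:
  fixes A :: "enat set"
  assumes "0 \<notin> A"
  shows "Inf A = 1 \<longleftrightarrow> 1 \<in> A"
proof
  assume "Inf A = 1"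
  then show "1 \<in> A"
    by (metis Inf_enat_def LeastI all_not_in_conv infinity_ne_i1)
next
  assume "1 \<in> A"
  moreover have "1 \<le> x" if "x \<in> A" for x using that assms by (metis ileI1 one_eSuc not_gr_zero)
  ultimately show "Inf A = 1" by (meson Inf_greatest Inf_lower antisym)
qed

theorem theorem2:
  fixes V :: "'a set" and E :: "'a \<Rightarrow> 'a \<Rightarrow> bool" and s t :: 'a
  assumes "simple_graph V E" and "connected_graph V E" and "s \<in> V" and "t \<in> V"
  shows "dividing_number V E s t = 1 \<longleftrightarrow> vertex_connectivity V E s t = 1"
proof (cases "s = t \<or> E s t")
  case True
  then show ?thesis by (simp add: dividing_number_def vertex_connectivity_def)
next
  case False
  let ?D = "{enat k | k. k \<ge> 1 \<and> divider_wins V E s t k}"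
  let ?C = "{enat (card S) | S. S \<subseteq> V - {s, t} \<and> separates E S s t}"
  have "finite V" using assms(1) by (simp add: simple_graph_def)
  have "\<not> separates E {} s t"
    using assms by (simp add: separates_def connected_graph_def)
  \<comment> \<open>\<open>card\<close> is 0 on infinite sets as well; finiteness of
    \<open>V\<close> leaves only the empty set, which does not separate.\<close>
  then have "0 \<notin> ?C"
    using \<open>finite V\<close> by (auto simp: zero_enat_def dest: finite_subset)
  moreover have "0 \<notin> ?D" by (auto simp: zero_enat_def)
  moreover have "1 \<in> ?D \<longleftrightarrow> divider_wins V E s t 1" by (auto simp: one_enat_def)
  moreover have "1 \<in> ?C \<longleftrightarrow> (\<exists>v\<in>V - {s, t}. separates E {v} s t)"
  proof
    assume "1 \<in> ?C"
    then obtain S where S: "S \<subseteq> V - {s, t}" "separates E S s t" and "enat (card S) = 1"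
      by force
    then have "card S = 1" by (simp add: one_enat_def)
    then obtain v where "S = {v}" using card_1_singletonE by metis
    then show "\<exists>v\<in>V - {s, t}. separates E {v} s t" using S by auto
  next
    assume "\<exists>v\<in>V - {s, t}. separates E {v} s t"
    then obtain v where "v \<in> V - {s, t}" "separates E {v} s t" by blast
    then have "\<exists>S. 1 = enat (card S) \<and> S \<subseteq> V - {s, t} \<and> separates E S s t"
      by (intro exI[of _ "{v}"]) (simp add: one_enat_def)
    then show "1 \<in> ?C" by (rule CollectI)
  qed
  moreover have "divider_wins V E s t 1 \<longleftrightarrow> (\<exists>v\<in>V - {s, t}. separates E {v} s t)"
  proof
    show "\<exists>v\<in>V - {s, t}. separates E {v} s t" if "divider_wins V E s t 1"
      using assms that by (rule cut_vertex_if_divider_wins)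
    show "divider_wins V E s t 1" if "\<exists>v\<in>V - {s, t}. separates E {v} s t"
      using that by (elim bexE) (rule divider_wins_if_cut_vertex[OF assms(1)])
  qed
  ultimately show ?thesis
    using False by (simp add: dividing_number_def vertex_connectivity_def Inf_enat_eq_1_iff)
qed

end
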